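(* (i) Let $(Q,\cdot,D,R)$ be a constellation with range. Then its derived category $(Q,\circ,D,R)$ (where $s\circ t:=s\cdot t$ if $R(s)=D(t)$, and is undefined otherwise), equipped with the natural order $\leq$ of the constellation $Q$, is an ordered category with restrictions, and for $s\in Q$ and $e\in D(Q)$ with $e\leq D(s)$ the restriction is $e|s=e\cdot s$. If moreover $(Q,\cdot,D,R)$ is left cancellative, then the derived category is left cancellative. (ii) Conversely, let $(C,\circ,D,R,\leq)$ be an ordered category with restrictions. Define a partial binary operation on $C$ by setting $s\cdot t:=s\circ(R(s)|t)$ whenever $R(s)\leq D(t)$ (and undefined otherwise). Then $(C,\cdot,D,R)$ is a constellation with range, and the given partial order $\leq$ is the natural order on this constellation. If moreover $(C,\circ,D,R)$ is left cancellative, then $(C,\cdot,D,R)$ is left cancellative.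
   Context: Categories (object-free). A category is a class $C$ with a partial binary operation $\circ$ such that: (C1) $x\circ(y\circ z)$ exists iff $(x\circ y)\circ z$ exists, and then they are equal; (C2) if $x\circ y$ and $y\circ z$ exist then so does $x\circ(y\circ z)$; (C3) for each $x$ there are identities $e,f$ with $e\circ x$ and $x\circ f$ existing, where an identity is an element $e$ such that $x\circ e=x$ whenever $x\circ e$ exists and $e\circ x=x$ whenever $e\circ x$ exists. These $e,f$ are unique and written $D(x)=e$, $R(x)=f$; $x\circ y$ exists iff $R(x)=D(y)$. $D(C)=\{D(x)\mid x\in C\}$ is the class of identities. A category is left cancellative if $a\circ b=a\circ c$ always implies $b=c$. Constellations. A constellation is a class $Q$ with a partial binary operation $\cdot$ such that: (Q1) if $x\cdot(y\cdot z)$ exists then $(x\cdot y)\cdot z$ exists and they are equal; (Q2) if $x\cdot y$ and $y\cdot z$ exist then so does $x\cdot(y\cdot z)$; (Q3) for each $x\in Q$ there is a unique right identity $e$ with $e\cdot x=x$ (a right identity is an $e$ such that $x\cdot e=x$ whenever $x\cdot e$ exists); put $D(x)=e$ and $D(Q)=\{D(x)\mid x\in Q\}$. The standard quasiorder on $D(Q)$ is $e\leq f$ iff $e\cdot f$ exists; the natural quasiorder on $Q$ (extending it) is $s\leq t$ iff $s=e\cdot t$ for some $e\in D(Q)$ (equivalently $s=D(s)\cdot t$). A constellation with pre-range is a constellation in which for each $s$ the set $\{e\in D(Q)\mid s\cdot e\text{ exists, and for all }f\in D(Q),\ s\cdot f\text{ exists implies }e\leq f\}$ has exactly one element, denoted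 $R(s)$; in this case the natural quasiorder is a partial order, called the natural order. A constellation with range is a constellation with pre-range such that $R(R(s)\cdot t)=R(s\cdot t)$ whenever $s\cdot t$ exists. It is left cancellative if $a\cdot b=a\cdot c$ implies $R(a)\cdot b=R(a)\cdot c$. Ordered categories with restrictions. This is a category $(C,\circ,D,R)$ with a partial order $\leq$ such that: (O1) if $a\leq b$, $c\leq d$ and $a\circ c$, $b\circ d$ exist then $a\circ c\leq b\circ d$; (O2) $a\leq b$ implies $D(a)\leq D(b)$; (O2$'$) $a\leq b$ implies $R(a)\leq R(b)$; (O3) if $s\in C$, $e\in D(C)$ and $e\leq D(s)$, then there is a unique $x\in C$ with $x\leq s$ and $D(x)=e$, denoted $e|s$. *)

theory Defs
  imports Main
begin

text \<open>
  A partial binary operation on a carrier \<open>C\<close> is a function \<open>m :: 'a \<Rightarrow> 'a \<Rightarrow> 'a option\<close>, where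
  \<open>m x y = None\<close> means that the product of \<open>x\<close> and \<open>y\<close> does not exist. The product
  \<open>x (y z)\<close> is \<open>Option.bind (m y z) (m x)\<close> and \<open>(x y) z\<close> is
  \<open>Option.bind (m x y) (\<lambda>u. m u z)\<close>. The maps \<open>D\<close> and \<open>R\<close> belong to the structure, as in the
  notation \<open>(C, \<circ>, D, R)\<close>; only their values on the carrier are constrained, and the
  axioms determine those values.
\<close>

locale partial_op =
  fixes C :: "'a set" and m :: "'a \<Rightarrow> 'a \<Rightarrow> 'a option"
  assumes closed: "m x y = Some z \<Longrightarrow> x \<in> C \<and> y \<in> C \<and> z \<in> C"

definition right_identity :: "'a set \<Rightarrow> ('a \<Rightarrow> 'a \<Rightarrow> 'a option) \<Rightarrow> 'a \<Rightarrow> bool" where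
  "right_identity C m e \<longleftrightarrow> e \<in> C \<and> (\<forall>x\<in>C. m x e \<noteq> None \<longrightarrow> m x e = Some x)"

definition left_identity :: "'a set \<Rightarrow> ('a \<Rightarrow> 'a \<Rightarrow> 'a option) \<Rightarrow> 'a \<Rightarrow> bool" where
  "left_identity C m e \<longleftrightarrow> e \<in> C \<and> (\<forall>x\<in>C. m e x \<noteq> None \<longrightarrow> m e x = Some x)"

definition identity :: "'a set \<Rightarrow> ('a \<Rightarrow> 'a \<Rightarrow> 'a option) \<Rightarrow> 'a \<Rightarrow> bool" where
  "identity C m e \<longleftrightarrow> right_identity C m e \<and> left_identity C m e"


section \<open>Categories\<close>

text \<open>
  Note the order of composition: \<open>D x\<close> is the identity on the left of \<open>x\<close>, and \<open>R x\<close> the one on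
  its right.
\<close>

locale category = partial_op C m
  for C :: "'a set" and m :: "'a \<Rightarrow> 'a \<Rightarrow> 'a option" +
  fixes D R :: "'a \<Rightarrow> 'a"
  assumes C1: "Option.bind (m y z) (m x) = Option.bind (m x y) (\<lambda>u. m u z)"
    and C2: "\<lbrakk>m x y \<noteq> None; m y z \<noteq> None\<rbrakk> \<Longrightarrow> Option.bind (m y z) (m x) \<noteq> None"
    and C3_D: "x \<in> C \<Longrightarrow> identity C m (D x) \<and> m (D x) x \<noteq> None"
    and C3_R: "x \<in> C \<Longrightarrow> identity C m (R x) \<and> m x (R x) \<noteq> None"

definition left_cancellative_category :: "('a \<Rightarrow> 'a \<Rightarrow> 'a option) \<Rightarrow> bool" where
  "left_cancellative_category m \<longleftrightarrow>
     (\<forall>a b c u. m a b = Some u \<and> m a c = Some u \<longrightarrow> b = c)"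

locale ordered_category_with_restrictions = category C m D R
  for C :: "'a set" and m :: "'a \<Rightarrow> 'a \<Rightarrow> 'a option" and D R :: "'a \<Rightarrow> 'a" +
  fixes le :: "'a rel"
  assumes partial_order: "partial_order_on C le"
    and O1: "\<lbrakk>(a, b) \<in> le; (c, d) \<in> le; m a c = Some u; m b d = Some v\<rbrakk> \<Longrightarrow> (u, v) \<in> le"
    and O2: "(a, b) \<in> le \<Longrightarrow> (D a, D b) \<in> le"
    and O2': "(a, b) \<in> le \<Longrightarrow> (R a, R b) \<in> le"
    and O3: "\<lbrakk>s \<in> C; e \<in> D ` C; (e, D s) \<in> le\<rbrakk> \<Longrightarrow> \<exists>!x. x \<in> C \<and> (x, s) \<in> le \<and> D x = e"

text \<open>The restriction \<open>e|s\<close>, meaningful when \<open>s \<in> C\<close>, \<open>e \<in> D ` C\<close> and \<open>(e, D s) \<in> le\<close>.\<close>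

definition restriction :: "'a set \<Rightarrow> ('a \<Rightarrow> 'a) \<Rightarrow> 'a rel \<Rightarrow> 'a \<Rightarrow> 'a \<Rightarrow> 'a" where
  "restriction C D le e s = (THE x. x \<in> C \<and> (x, s) \<in> le \<and> D x = e)"


section \<open>Constellations\<close>

locale constellation = partial_op Q m
  for Q :: "'a set" and m :: "'a \<Rightarrow> 'a \<Rightarrow> 'a option" +
  fixes D :: "'a \<Rightarrow> 'a"
  assumes Q1: "Option.bind (m y z) (m x) = Some w \<Longrightarrow> Option.bind (m x y) (\<lambda>u. m u z) = Some w"
    and Q2: "\<lbrakk>m x y \<noteq> None; m y z \<noteq> None\<rbrakk> \<Longrightarrow> Option.bind (m y z) (m x) \<noteq> None"
    and Q3: "x \<in> Q \<Longrightarrow> {e. right_identity Q m e \<and> m e x = Some x} = {D x}"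

definition standard_quasiorder ::
  "'a set \<Rightarrow> ('a \<Rightarrow> 'a \<Rightarrow> 'a option) \<Rightarrow> ('a \<Rightarrow> 'a) \<Rightarrow> 'a rel" where
  "standard_quasiorder Q m D = {(e, f). e \<in> D ` Q \<and> f \<in> D ` Q \<and> m e f \<noteq> None}"

definition natural_order ::
  "'a set \<Rightarrow> ('a \<Rightarrow> 'a \<Rightarrow> 'a option) \<Rightarrow> ('a \<Rightarrow> 'a) \<Rightarrow> 'a rel" where
  "natural_order Q m D = {(s, t). s \<in> Q \<and> t \<in> Q \<and> (\<exists>e\<in>D ` Q. m e t = Some s)}"

locale constellation_with_pre_range = constellation Q m D
  for Q :: "'a set" and m :: "'a \<Rightarrow> 'a \<Rightarrow> 'a option" and D :: "'a \<Rightarrow> 'a" +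
  fixes R :: "'a \<Rightarrow> 'a"
  assumes pre_range: "s \<in> Q \<Longrightarrow>
    {e \<in> D ` Q. m s e \<noteq> None \<and>
       (\<forall>f\<in>D ` Q. m s f \<noteq> None \<longrightarrow> (e, f) \<in> standard_quasiorder Q m D)} = {R s}"

locale constellation_with_range = constellation_with_pre_range Q m D R
  for Q :: "'a set" and m :: "'a \<Rightarrow> 'a \<Rightarrow> 'a option" and D R :: "'a \<Rightarrow> 'a" +
  assumes range: "m s t = Some u \<Longrightarrow> \<exists>v. m (R s) t = Some v \<and> R v = R u"

definition left_cancellative_constellation ::
  "('a \<Rightarrow> 'a \<Rightarrow> 'a option) \<Rightarrow> ('a \<Rightarrow> 'a) \<Rightarrow> bool" where
  "left_cancellative_constellation m R \<longleftrightarrow>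
     (\<forall>a b c u. m a b = Some u \<and> m a c = Some u \<longrightarrow>
        (\<exists>v. m (R a) b = Some v \<and> m (R a) c = Some v))"


section \<open>The two constructions\<close>

definition derived_comp ::
  "('a \<Rightarrow> 'a \<Rightarrow> 'a option) \<Rightarrow> ('a \<Rightarrow> 'a) \<Rightarrow> ('a \<Rightarrow> 'a) \<Rightarrow> 'a \<Rightarrow> 'a \<Rightarrow> 'a option" where
  "derived_comp m D R s t = (if R s = D t then m s t else None)"

definition restriction_product ::
  "'a set \<Rightarrow> ('a \<Rightarrow> 'a \<Rightarrow> 'a option) \<Rightarrow> ('a \<Rightarrow> 'a) \<Rightarrow> ('a \<Rightarrow> 'a) \<Rightarrow> 'a rel \<Rightarrow>
   'a \<Rightarrow> 'a \<Rightarrow> 'a option" where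
  "restriction_product C m D R le s t =
     (if s \<in> C \<and> t \<in> C \<and> (R s, D t) \<in> le then m s (restriction C D le (R s) t) else None)"

end

theory Submission imports Defs begin

text \<open>
  In a constellation, \<open>s t\<close> exists iff \<open>s D(t)\<close> exists, that is, iff \<open>R(s) \<le> D(t)\<close> when there is
  a pre-range. So every product is a composite in the category, after restricting its
  right factor: \<open>s t = s \<circ> (R(s) t)\<close>. Conversely, associativity of the
  product built from an ordered category rests on the two identities
  \<open>e|(f|s) = e|s\<close> and \<open>e|(s \<circ> t) = (e|s) \<circ> (R(e|s)|t)\<close>, both of which follow from
  the uniqueness of restrictions.
\<close>

section \<open>From constellations to ordered categories\<close>

context constellation
begin

lemma D_right_identity: "x \<in> Q \<Longrightarrow> right_identity Q m (D x)"
  and D_mult: "x \<in> Q \<Longrightarrow> m (D x) x = Some x"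
  using Q3[of x] by blast+

lemma D_unique: "\<lbrakk>right_identity Q m e; m e x = Some x\<rbrakk> \<Longrightarrow> D x = e"
  using Q3[of x] closed[of e x x] by (simp add: set_eq_iff) metis

lemma D_closed: "x \<in> Q \<Longrightarrow> D x \<in> Q"
  using D_right_identity unfolding right_identity_def by blast

lemma right_identity_mult: "\<lbrakk>right_identity Q m e; m x e \<noteq> None\<rbrakk> \<Longrightarrow> m x e = Some x"
  unfolding right_identity_def using closed by blast

text \<open>The product \<open>m (D e) e\<close> can be evaluated in two ways: it is
  \<open>e\<close> because \<open>D e\<close> is the domain of \<open>e\<close>, and
  \<open>D e\<close> because \<open>e\<close> is a right identity.\<close>

lemma D_right_id: "right_identity Q m e \<Longrightarrow> D e = e"
  using D_mult[of e] right_identity_mult[of e "D e"] unfolding right_identity_def by auto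

lemma D_image_iff: "e \<in> D ` Q \<longleftrightarrow> right_identity Q m e"
proof
  show "right_identity Q m e" if "e \<in> D ` Q"
    using that D_right_identity by blast
  show "e \<in> D ` Q" if "right_identity Q m e"
    using that D_right_id[OF that] unfolding right_identity_def by (metis imageI)
qed

lemma D_D [simp]: "x \<in> Q \<Longrightarrow> D (D x) = D x"
  by (simp add: D_right_id D_right_identity)

lemma assoc_right: "\<lbrakk>m y z = Some v; m x v = Some w\<rbrakk> \<Longrightarrow> \<exists>u. m x y = Some u \<and> m u z = Some w"
  using Q1[of y z x w] by (auto simp: bind_eq_Some_conv)

lemma assoc_exists:
  assumes "m x y = Some u" "m y z = Some v"
  shows "\<exists>w. m x v = Some w \<and> m u z = Some w"
  using Q2[of x y z] assoc_right[OF assms(2)] assms by fastforce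

text \<open>By associativity \<open>D x\<close> fixes the product from the left because it fixes
  \<open>x\<close>; uniqueness of the domain does the rest.\<close>

lemma D_product: "m x y = Some u \<Longrightarrow> D u = D x"
  using assoc_exists[OF D_mult, of x y u] closed[of x y u]
  by (intro D_unique D_right_identity) auto

text \<open>Write \<open>y\<close> as \<open>D y\<close> times \<open>y\<close> and reassociate in
  either direction. Existence of products is thereby reduced to identities on the right.\<close>

lemma mult_exists_iff: "\<lbrakk>x \<in> Q; y \<in> Q\<rbrakk> \<Longrightarrow> m x y \<noteq> None \<longleftrightarrow> m x (D y) \<noteq> None"
  using assoc_right[OF D_mult, of y x] assoc_exists[OF _ D_mult, of x y] by fastforce

text \<open>A product has the domain of its left factor, so the identity in the definition is forced
  to be \<open>D s\<close>. The order becomes equational.\<close>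

lemma natural_order_iff: "(s, t) \<in> natural_order Q m D \<longleftrightarrow> m (D s) t = Some s"
proof
  assume "(s, t) \<in> natural_order Q m D"
  then obtain e where e: "e \<in> D ` Q" "m e t = Some s"
    by (auto simp: natural_order_def)
  then have "D s = e"
    using D_product D_image_iff D_right_id by metis
  with e show "m (D s) t = Some s" by simp
next
  assume a: "m (D s) t = Some s"
  then show "(s, t) \<in> natural_order Q m D"
    using closed[OF a] by (auto simp: natural_order_def)
qed

lemma natural_order_identities:
  "\<lbrakk>e \<in> D ` Q; f \<in> D ` Q\<rbrakk> \<Longrightarrow> (e, f) \<in> natural_order Q m D \<longleftrightarrow> m e f \<noteq> None"
  using right_identity_mult[of f e] by (simp add: natural_order_iff D_image_iff D_right_id) blast

text \<open>Since \<open>f\<close> is a right identity, \<open>m e f\<close> is \<open>e\<close>,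
  and Q2 links \<open>e\<close> to \<open>x\<close> through \<open>f\<close>. For an identity
  \<open>x\<close> this is transitivity.\<close>

lemma standard_quasiorder_trans:
  assumes "(e, f) \<in> standard_quasiorder Q m D" "m f x \<noteq> None"
  shows "m e x \<noteq> None"
proof -
  have "m e f = Some e"
    using assms(1) right_identity_mult[of f e] by (simp add: standard_quasiorder_def D_image_iff)
  with assms(2) show ?thesis
    using assoc_exists by fastforce
qed

lemma natural_order_D:
  assumes "(s, t) \<in> natural_order Q m D"
  shows "m (D s) (D t) \<noteq> None"
  using assms mult_exists_iff[of "D s" t] closed[of "D s" t s] by (auto simp: natural_order_iff)

lemma natural_order_trans:
  assumes "(s, t) \<in> natural_order Q m D" "(t, u) \<in> natural_order Q m D"
  shows "(s, u) \<in> natural_order Q m D"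
proof -
  have s: "m (D s) t = Some s" and t: "m (D t) u = Some t"
    using assms by (auto simp: natural_order_iff)
  \<comment> \<open>Reassociate \<open>s\<close> as \<open>(D s D t) u\<close>; the inner product is
    \<open>D s\<close> because \<open>D t\<close> is a right identity.\<close>
  obtain v where "m (D s) (D t) = Some v" "m v u = Some s"
    using assoc_right[OF t s] by blast
  moreover have "right_identity Q m (D t)"
    using D_right_identity closed[OF t] by blast
  ultimately show ?thesis
    using right_identity_mult by (fastforce simp: natural_order_iff)
qed

end

section \<open>Pre-range: antisymmetry, monotonicity and restrictions\<close>

context constellation_with_pre_range
begin

lemma R_iff:
  assumes "s \<in> Q"
  shows "e \<in> D ` Q \<and> m s e \<noteq> None \<and>
     (\<forall>f\<in>D ` Q. m s f \<noteq> None \<longrightarrow> (e, f) \<in> standard_quasiorder Q m D) \<longleftrightarrow> e = R s"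
  using eqset_imp_iff[OF pre_range[OF assms], of e] unfolding mem_Collect_eq singleton_iff .

lemma R_image: "s \<in> Q \<Longrightarrow> R s \<in> D ` Q"
  and mult_R_exists: "s \<in> Q \<Longrightarrow> m s (R s) \<noteq> None"
  and R_least:
    "\<lbrakk>s \<in> Q; f \<in> D ` Q; m s f \<noteq> None\<rbrakk> \<Longrightarrow> (R s, f) \<in> standard_quasiorder Q m D"
  using R_iff[of s "R s", THEN iffD2, OF _ refl] by blast+

lemma R_unique:
  assumes "s \<in> Q" "e \<in> D ` Q" "m s e \<noteq> None"
    and "\<And>f. \<lbrakk>f \<in> D ` Q; m s f \<noteq> None\<rbrakk> \<Longrightarrow> (e, f) \<in> standard_quasiorder Q m D"
  shows "R s = e"
  by (rule R_iff[THEN iffD1, symmetric]) (use assms in simp_all)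

lemma mult_R: "s \<in> Q \<Longrightarrow> m s (R s) = Some s"
  using R_image mult_R_exists right_identity_mult D_image_iff by blast

lemma R_closed: "s \<in> Q \<Longrightarrow> R s \<in> Q"
  using R_image[of s] D_closed by fastforce

lemma D_image_square: "e \<in> D ` Q \<Longrightarrow> m e e = Some e"
proof -
  assume "e \<in> D ` Q"
  then obtain x where "x \<in> Q" "e = D x" by blast
  then show ?thesis using D_mult[of "D x"] D_closed by simp
qed

lemma R_identity: "e \<in> D ` Q \<Longrightarrow> R e = e"
  using D_closed by (intro R_unique[of e e]) (simp_all add: standard_quasiorder_def D_image_square image_iff, blast)

text \<open>Both \<open>e\<close> and \<open>f\<close> meet the conditions that single out
  \<open>R e\<close>, so uniqueness of the pre-range gives antisymmetry.\<close>

lemma standard_quasiorder_antisym: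
  assumes "(e, f) \<in> standard_quasiorder Q m D" "(f, e) \<in> standard_quasiorder Q m D"
  shows "e = f"
proof -
  have "e \<in> D ` Q" "f \<in> D ` Q" "m e f \<noteq> None"
    using assms by (auto simp: standard_quasiorder_def)
  then have "R e = f"
    using standard_quasiorder_trans[OF assms(2)] D_closed
    by (intro R_unique[of e f]) (auto simp: standard_quasiorder_def)
  then show ?thesis using R_identity \<open>e \<in> D ` Q\<close> by simp
qed

lemma natural_order_partial_order: "partial_order_on Q (natural_order Q m D)"
  unfolding partial_order_on_def preorder_on_def
proof (intro conjI)
  show "natural_order Q m D \<subseteq> Q \<times> Q"
    by (auto simp: natural_order_def)
  show "refl_on Q (natural_order Q m D)"
    by (auto simp: refl_on_def natural_order_iff D_mult)
  show "trans (natural_order Q m D)"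
    using natural_order_trans by (rule transI)
  show "antisym (natural_order Q m D)"
  proof (rule antisymI)
    fix s t
    assume st: "(s, t) \<in> natural_order Q m D" and ts: "(t, s) \<in> natural_order Q m D"
    then have Q: "s \<in> Q" "t \<in> Q" by (auto simp: natural_order_def)
    \<comment> \<open>The two domains lie below each other. Once they agree, \<open>s\<close> is
      \<open>D t\<close> times \<open>t\<close>, which is \<open>t\<close>.\<close>
    have "D s = D t"
      using natural_order_D[OF st] natural_order_D[OF ts] Q
      by (intro standard_quasiorder_antisym) (auto simp: standard_quasiorder_def)
    then show "s = t"
      using st D_mult Q by (auto simp: natural_order_iff)
  qed
qed

lemma mult_exists: "\<lbrakk>s \<in> Q; t \<in> Q; R s = D t\<rbrakk> \<Longrightarrow> m s t \<noteq> None"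
  using mult_exists_iff[of s t] mult_R_exists[of s] by simp

lemma natural_order_R:
  assumes "(a, b) \<in> natural_order Q m D"
  shows "(R a, R b) \<in> natural_order Q m D"
proof -
  have e: "m (D a) b = Some a" and Q: "a \<in> Q" "b \<in> Q"
    using assms closed by (auto simp: natural_order_iff)
  \<comment> \<open>Since \<open>a\<close> is \<open>D a\<close> times \<open>b\<close> and
    \<open>b\<close> composes with \<open>R b\<close>, so does \<open>a\<close>; minimality of
    \<open>R a\<close> then applies.\<close>
  have "m a (R b) \<noteq> None"
    using assoc_exists[OF e mult_R] Q by auto
  then show ?thesis
    using R_least[of a "R b"] R_image Q natural_order_identities
    by (auto simp: standard_quasiorder_def)
qed

lemma natural_order_mult:
  assumes "(a, b) \<in> natural_order Q m D" "(c, d) \<in> natural_order Q m D"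
    and u: "m a c = Some u" and v: "m b d = Some v"
  shows "(u, v) \<in> natural_order Q m D"
proof -
  have a: "m (D a) b = Some a" and c: "m (D c) d = Some c"
    using assms by (auto simp: natural_order_iff)
  \<comment> \<open>Reassociating shows that \<open>D a\<close> times \<open>v\<close> is
    \<open>a d\<close>.\<close>
  obtain w where w: "m (D a) v = Some w" "m a d = Some w"
    using assoc_exists[OF a v] by blast
  \<comment> \<open>Similarly \<open>u = a (D(c) d) = (a D(c)) d = a d\<close>, so \<open>u\<close>
    is \<open>D a\<close> times \<open>v\<close>.\<close>
  obtain x where "m a (D c) = Some x" "m x d = Some u"
    using assoc_right[OF c u] by blast
  moreover have "right_identity Q m (D c)"
    using D_right_identity closed[OF u] by blast
  ultimately have "m a d = Some u"
    using right_identity_mult by fastforce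
  then show ?thesis using w D_product[OF u] by (simp add: natural_order_iff)
qed

lemma restriction_exists:
  assumes "s \<in> Q" "e \<in> D ` Q" "(e, D s) \<in> natural_order Q m D"
  obtains x where "m e s = Some x" "x \<in> Q" "(x, s) \<in> natural_order Q m D" "D x = e"
proof -
  have "e \<in> Q" using assms(2) D_closed by auto
  have "m e (D s) \<noteq> None"
    using assms natural_order_identities by blast
  then obtain x where x: "m e s = Some x"
    using mult_exists_iff[OF \<open>e \<in> Q\<close> assms(1)] by blast
  have "D x = e"
    using D_product[OF x] assms(2) D_image_iff D_right_id by metis
  then show ?thesis
    using that x closed[OF x] by (simp add: natural_order_iff)
qed

lemma restriction_eq_mult:
  assumes "s \<in> Q" "e \<in> D ` Q" "(e, D s) \<in> natural_order Q m D"
  shows "m e s = Some (restriction Q D (natural_order Q m D) e s)"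
proof -
  obtain x where x: "m e s = Some x" "x \<in> Q" "(x, s) \<in> natural_order Q m D" "D x = e"
    using restriction_exists[OF assms] .
  \<comment> \<open>An element below \<open>s\<close> with domain \<open>e\<close> must be the value
    of \<open>m e s\<close>, which gives uniqueness.\<close>
  then have "restriction Q D (natural_order Q m D) e s = x"
    unfolding restriction_def by (intro the_equality) (auto simp: natural_order_iff)
  with x show ?thesis by simp
qed

lemma derived_left_cancellative:
  assumes "left_cancellative_constellation m R"
  shows "left_cancellative_category (derived_comp m D R)"
  unfolding left_cancellative_category_def
proof (intro allI impI, elim conjE)
  fix a b c u
  assume "derived_comp m D R a b = Some u" "derived_comp m D R a c = Some u"
  then have b: "R a = D b" "m a b = Some u" and c: "R a = D c" "m a c = Some u"
    by (auto simp: derived_comp_def split: if_splits)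
  then obtain v where "m (R a) b = Some v" "m (R a) c = Some v"
    using assms unfolding left_cancellative_constellation_def by blast
  \<comment> \<open>As \<open>R a\<close> is the domain of both \<open>b\<close> and
    \<open>c\<close>, multiplying by it changes neither.\<close>
  then show "b = c"
    using b c D_mult closed by (metis option.inject)
qed

end

section \<open>The derived category\<close>

context constellation_with_range
begin

text \<open>When \<open>R s\<close> is the domain of \<open>t\<close>, the product
  \<open>m (R s) t\<close> is \<open>t\<close>, and the range axiom becomes the category law for
  ranges.\<close>

lemma R_product:
  assumes "R s = D t" "m s t = Some u"
  shows "R u = R t"
proof -
  have "t \<in> Q" using closed[OF assms(2)] by blast
  then show ?thesis using range[OF assms(2)] assms(1) D_mult by auto
qed

lemma derived_category: "category Q (derived_comp m D R) D R"
proof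
  let ?d = "derived_comp m D R"
  have d_iff: "?d x y = Some u \<longleftrightarrow> R x = D y \<and> m x y = Some u" for x y u
    by (simp add: derived_comp_def)
  have d_exists: "?d x y \<noteq> None \<longleftrightarrow> x \<in> Q \<and> y \<in> Q \<and> R x = D y" for x y
    using mult_exists[of x y] closed[of x y] by (auto simp: derived_comp_def)
  have D_D_R: "D (R s) = R s" if "s \<in> Q" for s
    using R_image[OF that] by auto
  show "x \<in> Q \<and> y \<in> Q \<and> z \<in> Q" if "?d x y = Some z" for x y z
    using that closed[of x y z] by (simp add: d_iff)
  \<comment> \<open>The domain of \<open>y z\<close> is \<open>D y\<close> and the range of
    \<open>x y\<close> is \<open>R y\<close>, so the outer composites also satisfy the matching
    condition.\<close>
  have left: "\<exists>v w. ?d y z = Some v \<and> ?d x v = Some w \<and> ?d u z = Some w"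
    if xy: "?d x y = Some u" and yz: "?d y z \<noteq> None" for x y z u
  proof -
    obtain v where v: "?d y z = Some v" using yz by blast
    obtain w where "m x v = Some w" "m u z = Some w"
      using assoc_exists[of x y u z v] xy v by (auto simp: d_iff)
    then show ?thesis
      using xy v R_product[of x y u] D_product[of y z v] by (simp add: d_iff)
  qed
  show "Option.bind (?d y z) (?d x) = Option.bind (?d x y) (\<lambda>u. ?d u z)" for x y z
  proof (cases "?d x y \<noteq> None \<and> ?d y z \<noteq> None")
    case True
    then show ?thesis using left[of x y _ z] by auto
  next
    case False
    \<comment> \<open>Here \<open>D v = D y\<close>, so composability of \<open>x\<close> with
      \<open>v\<close> would give composability of \<open>x\<close> with \<open>y\<close>; the case
      of \<open>u\<close> is dual, through ranges.\<close>
    have "?d x v = None" if "?d y z = Some v" "?d x y = None" for v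
      using that d_exists[of x v] d_exists[of x y] d_exists[of y z] D_product[of y z v]
      by (auto simp: d_iff)
    moreover have "?d u z = None" if "?d x y = Some u" "?d y z = None" for u
      using that d_exists[of u z] d_exists[of x y] d_exists[of y z] R_product[of x y u]
      by (auto simp: d_iff)
    ultimately show ?thesis
      using False by (cases "?d y z"; cases "?d x y") auto
  qed
  show "Option.bind (?d y z) (?d x) \<noteq> None" if "?d x y \<noteq> None" "?d y z \<noteq> None" for x y z
    using that left[of x y _ z] by auto
  \<comment> \<open>A right identity becomes two-sided: composability of \<open>e\<close> with
    \<open>x\<close> now means \<open>e = R e = D x\<close>.\<close>
  have ident: "identity Q ?d e" if e: "e \<in> D ` Q" for e
  proof -
    have eQ: "e \<in> Q" using e D_closed by auto
    have "?d x e = Some x" if "?d x e \<noteq> None" for x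
      using that right_identity_mult[of e x] e D_image_iff by (auto simp: derived_comp_def split: if_splits)
    moreover have "?d e x = Some x" if "?d e x \<noteq> None" "x \<in> Q" for x
      using that D_mult R_identity[OF e] by (auto simp: derived_comp_def split: if_splits)
    ultimately show ?thesis
      using eQ unfolding identity_def right_identity_def left_identity_def by blast
  qed
  show "identity Q ?d (D x) \<and> ?d (D x) x \<noteq> None" if "x \<in> Q" for x
    using that ident[of "D x"] d_exists[of "D x" x] R_identity[of "D x"] D_closed by simp
  show "identity Q ?d (R x) \<and> ?d x (R x) \<noteq> None" if "x \<in> Q" for x
    using that ident[of "R x"] d_exists[of x "R x"] R_image R_closed D_D_R by simp
qed

lemma derived_ordered_category:
  "ordered_category_with_restrictions Q (derived_comp m D R) D R (natural_order Q m D)"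
proof -
  interpret derived: category Q "derived_comp m D R" D R
    by (rule derived_category)
  show ?thesis
  proof
    show "partial_order_on Q (natural_order Q m D)"
      by (rule natural_order_partial_order)
    show "(u, v) \<in> natural_order Q m D"
      if "(a, b) \<in> natural_order Q m D" "(c, d) \<in> natural_order Q m D"
        "derived_comp m D R a c = Some u" "derived_comp m D R b d = Some v" for a b c d u v
      using natural_order_mult[OF that(1,2)] that(3,4) by (simp add: derived_comp_def split: if_splits)
    show "(D a, D b) \<in> natural_order Q m D" if "(a, b) \<in> natural_order Q m D" for a b
      using that natural_order_D[OF that] natural_order_identities[of "D a" "D b"]
      by (simp add: natural_order_def)
    show "(R a, R b) \<in> natural_order Q m D" if "(a, b) \<in> natural_order Q m D" for a b
      using that by (rule natural_order_R)
    show "\<exists>!x. x \<in> Q \<and> (x, s) \<in> natural_order Q m D \<and> D x = e"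
      if e: "s \<in> Q" "e \<in> D ` Q" "(e, D s) \<in> natural_order Q m D" for s e
    proof -
      obtain x where "m e s = Some x" "x \<in> Q" "(x, s) \<in> natural_order Q m D" "D x = e"
        using restriction_exists[OF e] .
      then show ?thesis by (intro ex1I[of _ x]) (auto simp: natural_order_iff)
    qed
  qed
qed

end


section \<open>From ordered categories to constellations\<close>

context category
begin

lemma identity_mult_left: "\<lbrakk>identity C m e; m e x \<noteq> None\<rbrakk> \<Longrightarrow> m e x = Some x"
  and identity_mult_right: "\<lbrakk>identity C m e; m x e \<noteq> None\<rbrakk> \<Longrightarrow> m x e = Some x"
  unfolding identity_def left_identity_def right_identity_def using closed by blast+

lemma D_comp: "x \<in> C \<Longrightarrow> m (D x) x = Some x"
  using C3_D identity_mult_left by blast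

lemma comp_R: "x \<in> C \<Longrightarrow> m x (R x) = Some x"
  using C3_R identity_mult_right by blast

lemma D_closed: "x \<in> C \<Longrightarrow> D x \<in> C"
  using D_comp closed by blast

lemma R_closed: "x \<in> C \<Longrightarrow> R x \<in> C"
  using comp_R closed by blast

lemma identity_closed: "identity C m e \<Longrightarrow> e \<in> C"
  unfolding identity_def left_identity_def by blast

lemma D_identity: "identity C m e \<Longrightarrow> D e = e"
  using D_comp[of e] identity_mult_right[of e "D e"] identity_closed by simp

lemma R_identity: "identity C m e \<Longrightarrow> R e = e"
  using comp_R[of e] identity_mult_left[of e "R e"] identity_closed by simp

lemma D_D [simp]: "x \<in> C \<Longrightarrow> D (D x) = D x"
  and R_D [simp]: "x \<in> C \<Longrightarrow> R (D x) = D x"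
  and D_R [simp]: "x \<in> C \<Longrightarrow> D (R x) = R x"
  and R_R [simp]: "x \<in> C \<Longrightarrow> R (R x) = R x"
  by (simp_all add: C3_D C3_R D_identity R_identity)

lemma comp_assoc: "\<lbrakk>m x y = Some u; m y z = Some v\<rbrakk> \<Longrightarrow> m x v = m u z"
  using C1[of y z x] by simp

text \<open>If \<open>x y\<close> exists, inserting \<open>R x\<close> and then \<open>D y\<close>
  between the factors shows that these two identities compose; their composite equals both.
  Conversely, C2 composes \<open>x\<close> and \<open>y\<close> through the common identity.\<close>

lemma comp_exists_iff: "m x y \<noteq> None \<longleftrightarrow> x \<in> C \<and> y \<in> C \<and> R x = D y"
proof
  assume a: "m x y \<noteq> None"
  then have C: "x \<in> C" "y \<in> C" using closed by blast+
  have "m (R x) y \<noteq> None"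
    using C1[of "R x" y x] a comp_R[OF C(1)] by (cases "m (R x) y") auto
  then have "m (R x) y = Some y"
    using C3_R C(1) identity_mult_left by blast
  then have "m (R x) (D y) \<noteq> None"
    using C1[of "D y" y "R x"] D_comp[OF C(2)] by (cases "m (R x) (D y)") auto
  then have "R x = D y"
    using identity_mult_left[of "R x" "D y"] identity_mult_right[of "D y" "R x"]
      C3_R[OF C(1)] C3_D[OF C(2)] by simp
  then show "x \<in> C \<and> y \<in> C \<and> R x = D y" using C by simp
next
  assume "x \<in> C \<and> y \<in> C \<and> R x = D y"
  then show "m x y \<noteq> None"
    using C2[of x "R x" y] comp_R[of x] D_comp[of y] by simp
qed

lemma comp_obtain:
  assumes "x \<in> C" "y \<in> C" "R x = D y"
  obtains u where "m x y = Some u" "u \<in> C"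
  using comp_exists_iff closed assms by blast

lemma D_product: assumes "m x y = Some u" shows "D u = D x"
proof -
  have C: "x \<in> C" "u \<in> C" using closed[OF assms] by blast+
  have "m (D x) u \<noteq> None"
    using comp_assoc[OF D_comp assms] C assms by simp
  then show ?thesis using comp_exists_iff[of "D x" u] C by simp
qed

lemma R_product: assumes "m x y = Some u" shows "R u = R y"
proof -
  have C: "y \<in> C" "u \<in> C" using closed[OF assms] by blast+
  have "m u (R y) \<noteq> None"
    using comp_assoc[OF assms comp_R[OF C(1)]] assms by (metis option.distinct(1))
  then show ?thesis using comp_exists_iff[of u "R y"] C by simp
qed

end

section \<open>Calculus of restrictions in an ordered category\<close>

context ordered_category_with_restrictions
begin

abbreviation restr :: "'a \<Rightarrow> 'a \<Rightarrow> 'a" where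
  "restr \<equiv> restriction C D le"

abbreviation prod :: "'a \<Rightarrow> 'a \<Rightarrow> 'a option" where
  "prod \<equiv> restriction_product C m D R le"

lemma le_closed: "(a, b) \<in> le \<Longrightarrow> a \<in> C \<and> b \<in> C"
  and le_refl: "a \<in> C \<Longrightarrow> (a, a) \<in> le"
  and le_trans: "\<lbrakk>(a, b) \<in> le; (b, d) \<in> le\<rbrakk> \<Longrightarrow> (a, d) \<in> le"
  and le_antisym: "\<lbrakk>(a, b) \<in> le; (b, a) \<in> le\<rbrakk> \<Longrightarrow> a = b"
  using partial_order unfolding partial_order_on_def preorder_on_def refl_on_def
  by (blast dest: transD antisymD)+

text \<open>For elements of \<open>C\<close>, \<open>D e = e\<close> expresses membership in the
  image of \<open>D\<close>, in a form suited to rewriting.\<close>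

lemma restr:
  assumes "s \<in> C" "D e = e" "(e, D s) \<in> le"
  shows restr_closed: "restr e s \<in> C" and restr_le: "(restr e s, s) \<in> le"
    and D_restr: "D (restr e s) = e"
proof -
  have "e \<in> D ` C" using le_closed[OF assms(3)] assms(2) by (metis imageI)
  then show "restr e s \<in> C" "(restr e s, s) \<in> le" "D (restr e s) = e"
    using theI'[OF O3[OF assms(1) _ assms(3)]] unfolding restriction_def by blast+
qed

text \<open>By uniqueness in O3. To identify an element with a restriction of \<open>s\<close>, it
  now suffices to place it below \<open>s\<close> and compute its domain.\<close>

lemma restr_D:
  assumes "(x, s) \<in> le"
  shows "restr (D x) s = x"
proof -
  have C: "x \<in> C" "s \<in> C" using le_closed[OF assms] by blast+
  then show ?thesis
    unfolding restriction_def using O3[of s "D x"] O2[OF assms] assms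
    by (intro the1_equality) auto
qed

lemma restr_restr:
  assumes "s \<in> C" "D e = e" "D f = f" "(e, f) \<in> le" "(f, D s) \<in> le"
  shows "restr e (restr f s) = restr e s"
proof -
  have "(restr e (restr f s), s) \<in> le"
    using restr[of s f] restr[of "restr f s" e] le_trans assms by simp
  moreover have "D (restr e (restr f s)) = e"
    using restr[of s f] restr[of "restr f s" e] assms by simp
  ultimately show ?thesis using restr_D by metis
qed

text \<open>Restricting \<open>s\<close> may lower its range, so \<open>t\<close> has to be
  restricted to the new range for the factors to match.\<close>

lemma restr_comp:
  assumes st: "m s t = Some u" and e: "D e = e" "(e, D s) \<in> le"
  shows "(R (restr e s), D t) \<in> le"
    and "m (restr e s) (restr (R (restr e s)) t) = Some (restr e u)"
proof -
  have C: "s \<in> C" "t \<in> C" "R s = D t"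
    using comp_exists_iff[of s t] st by auto
  note es = restr[OF C(1) e]
  show le: "(R (restr e s), D t) \<in> le"
    using O2'[OF es(2)] C by simp
  note r = restr[OF C(2) D_R[OF es(1)] le]
  obtain v where v: "m (restr e s) (restr (R (restr e s)) t) = Some v"
    using comp_obtain[OF es(1) r(1)] r(3) by auto
  \<comment> \<open>The restricted factors lie below \<open>s\<close> and \<open>t\<close>, so O1
    puts their composite below \<open>u\<close>, and its domain is \<open>e\<close>.\<close>
  have "(v, u) \<in> le" using O1[OF es(2) r(2) v st] .
  then have "v = restr e u"
    using restr_D D_product[OF v] es(3) by metis
  with v show "m (restr e s) (restr (R (restr e s)) t) = Some (restr e u)" by simp
qed

section \<open>The product built from restrictions, and its associativity\<close>

lemma prod_iff:
  "prod s t = Some u \<longleftrightarrow>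
     s \<in> C \<and> t \<in> C \<and> (R s, D t) \<in> le \<and> m s (restr (R s) t) = Some u"
  by (auto simp: restriction_product_def)

text \<open>The restriction of \<open>t\<close> has domain \<open>R s\<close>, so the composite with
  \<open>s\<close> exists whenever the restriction is meaningful.\<close>

lemma prod_exists_iff: "prod s t \<noteq> None \<longleftrightarrow> s \<in> C \<and> t \<in> C \<and> (R s, D t) \<in> le"
proof
  assume "s \<in> C \<and> t \<in> C \<and> (R s, D t) \<in> le"
  then show "prod s t \<noteq> None"
    using restr[of t "R s"] comp_exists_iff by (simp add: restriction_product_def)
qed (auto simp: restriction_product_def split: if_splits)

lemma D_prod: "prod s t = Some u \<Longrightarrow> D u = D s"
  using D_product by (auto simp: prod_iff)

lemma R_prod: "prod s t = Some u \<Longrightarrow> R u = R (restr (R s) t)"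
  using R_product by (auto simp: prod_iff)

text \<open>As \<open>R e = e\<close>, the product is \<open>e\<close> composed with
  \<open>restr e t\<close>, and \<open>e\<close> is the domain of that restriction.\<close>

lemma prod_identity_left:
  assumes "t \<in> C" "D e = e" "(e, D t) \<in> le"
  shows "prod e t = Some (restr e t)"
proof -
  have "e \<in> C" "R e = e"
    using le_closed[OF assms(3)] R_D[of e] assms(2) by auto
  then show ?thesis
    using restr[OF assms] assms D_comp[of "restr e t"] by (auto simp: prod_iff)
qed

text \<open>Restricting \<open>e\<close> to the smaller identity \<open>R s\<close> gives
  \<open>R s\<close> itself.\<close>

lemma prod_identity_right:
  assumes "s \<in> C" "D e = e" "(R s, e) \<in> le"
  shows "prod s e = Some s"
  using assms restr_D[OF assms(3)] comp_R le_closed[OF assms(3)] by (auto simp: prod_iff)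

lemma prod_assoc:
  assumes yz: "prod y z = Some v" and xv: "prod x v = Some w"
  shows "\<exists>u. prod x y = Some u \<and> prod u z = Some w"
proof -
  have C: "x \<in> C" "y \<in> C" "z \<in> C" "v \<in> C" using assms closed by (auto simp: prod_iff)
  have yz': "(R y, D z) \<in> le" "m y (restr (R y) z) = Some v" using yz by (auto simp: prod_iff)
  have xy: "(R x, D y) \<in> le" using xv D_prod[OF yz] by (simp add: prod_iff)
  \<comment> \<open>The right factor that \<open>prod x y\<close> composes with \<open>x\<close>; it
    is meaningful since \<open>v\<close> and \<open>y\<close> have the same domain.\<close>
  define y' where "y' = restr (R x) y"
  have y': "y' \<in> C" "(y', y) \<in> le" "D y' = R x"
    unfolding y'_def using restr[OF C(2) _ xy] C by auto
  obtain u where u: "prod x y = Some u" "m x y' = Some u"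
    using prod_exists_iff[of x y] C xy by (auto simp: prod_iff y'_def)
  have Ru: "R u = R y'" using R_product[OF u(2)] .
  have Ry': "(R y', R y) \<in> le" using O2'[OF y'(2)] .
  \<comment> \<open>Restricting the composite \<open>v\<close> to \<open>R x\<close> turns its
    factor \<open>y\<close> into \<open>y'\<close>; the nested restrictions of \<open>z\<close> then
    collapse into one.\<close>
  have "m y' (restr (R y') (restr (R y) z)) = Some (restr (R x) v)"
    unfolding y'_def using restr_comp(2)[OF yz'(2)] C xy by simp
  then have z': "m y' (restr (R y') z) = Some (restr (R x) v)"
    using restr_restr[OF C(3) _ _ Ry' yz'(1)] y' C by simp
  \<comment> \<open>Category associativity moves \<open>x\<close> onto \<open>y'\<close>. Since
    \<open>R u = R y'\<close>, the result is \<open>prod u z\<close>.\<close>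
  have "m u (restr (R y') z) = Some w"
    using comp_assoc[OF u(2) z'] xv by (simp add: prod_iff)
  moreover have "u \<in> C" using closed u(2) by blast
  ultimately have "prod u z = Some w"
    using Ru C le_trans[OF Ry' yz'(1)] by (simp add: prod_iff)
  with u show ?thesis by blast
qed

section \<open>Constellation axioms, range, natural order and cancellation\<close>

lemma restriction_product_constellation: "constellation C prod D"
proof
  show "x \<in> C \<and> y \<in> C \<and> z \<in> C" if "prod x y = Some z" for x y z
    using that closed by (auto simp: prod_iff)
  show "Option.bind (prod x y) (\<lambda>u. prod u z) = Some w"
    if "Option.bind (prod y z) (prod x) = Some w" for x y z w
    using that prod_assoc by (fastforce simp: bind_eq_Some_conv)
  show "Option.bind (prod y z) (prod x) \<noteq> None" if xy: "prod x y \<noteq> None" and "prod y z \<noteq> None"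
    for x y z
  proof -
    obtain v where v: "prod y z = Some v" using \<open>prod y z \<noteq> None\<close> by blast
    then have "v \<in> C" using closed by (auto simp: prod_iff)
    then show ?thesis
      using v xy D_prod[OF v] prod_exists_iff by simp
  qed
  show "{e. right_identity C prod e \<and> prod e x = Some x} = {D x}" if x: "x \<in> C" for x
  proof (intro equalityI subsetI)
    fix e assume "e \<in> {e. right_identity C prod e \<and> prod e x = Some x}"
    then have e: "e \<in> C" "right_identity C prod e" "prod e x = Some x"
      by (auto simp: right_identity_def)
    \<comment> \<open>Uniqueness in Q3: this product is \<open>D e\<close> because \<open>e\<close>
      is a right identity, and \<open>e\<close> because restricting to the own domain changes
      nothing.\<close>
    have "prod (D e) e = Some (D e)"
      using e D_closed prod_exists_iff[of "D e" e] le_refl unfolding right_identity_def by auto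
    moreover have "prod (D e) e = Some e"
      using prod_identity_left[of e "D e"] restr_D[of e e] e le_refl D_closed by simp
    ultimately show "e \<in> {D x}" using D_prod[OF e(3)] by simp
  next
    fix e assume "e \<in> {D x}"
    then have e: "e = D x" by simp
    have "right_identity C prod e"
      using x D_closed prod_exists_iff prod_identity_right unfolding right_identity_def e by simp
    moreover have "prod e x = Some x"
      using prod_identity_left[of x e] restr_D[of x x] x le_refl D_closed e by simp
    ultimately show "e \<in> {e. right_identity C prod e \<and> prod e x = Some x}" by simp
  qed
qed

lemma restriction_product_constellation_with_range: "constellation_with_range C prod D R"
proof -
  interpret prod: constellation C prod D
    by (rule restriction_product_constellation)
  show ?thesis
  proof
    fix s assume s: "s \<in> C"
    have idem: "e \<in> C \<and> D e = e \<and> R e = e" if "e \<in> D ` C" for e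
      using that by (elim imageE) (simp add: D_closed)
    have std: "(e, f) \<in> standard_quasiorder C prod D \<longleftrightarrow> (e, f) \<in> le"
      if "e \<in> D ` C" "f \<in> D ` C" for e f
      using that idem[OF that(1)] idem[OF that(2)] prod_exists_iff[of e f]
      unfolding standard_quasiorder_def by simp
    have ex: "prod s e \<noteq> None \<longleftrightarrow> (R s, e) \<in> le" if "e \<in> D ` C" for e
      using idem[OF that] s prod_exists_iff[of s e] by simp
    have R: "R s \<in> D ` C" "(R s, R s) \<in> le"
      using s D_R R_closed le_refl by (metis imageI)+
    \<comment> \<open>In terms of \<open>le\<close>, the condition asks for a least identity above
      \<open>R s\<close>; testing it on \<open>R s\<close> and using antisymmetry identifies
      it.\<close>
    have "e \<in> D ` C \<and> prod s e \<noteq> None \<and>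
        (\<forall>f\<in>D ` C. prod s f \<noteq> None \<longrightarrow> (e, f) \<in> standard_quasiorder C prod D)
        \<longleftrightarrow> e = R s" for e
      using ex std R le_antisym by metis
    then show "{e \<in> D ` C. prod s e \<noteq> None \<and>
        (\<forall>f\<in>D ` C. prod s f \<noteq> None \<longrightarrow> (e, f) \<in> standard_quasiorder C prod D)} = {R s}"
      by blast
  next
    fix s t u assume st: "prod s t = Some u"
    then have C: "s \<in> C" "t \<in> C" "(R s, D t) \<in> le" by (auto simp: prod_iff)
    then have "prod (R s) t = Some (restr (R s) t)" by (intro prod_identity_left) auto
    with R_prod[OF st] show "\<exists>v. prod (R s) t = Some v \<and> R v = R u" by simp
  qed
qed

text \<open>Multiplying by an identity on the left is restriction, and the elements below
  \<open>t\<close> are exactly its restrictions.\<close>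

lemma natural_order_restriction_product: "natural_order C prod D = le"
proof (intro equalityI subrelI)
  fix s t assume "(s, t) \<in> natural_order C prod D"
  then obtain e where e: "e \<in> D ` C" "prod e t = Some s" and t: "t \<in> C"
    by (auto simp: natural_order_def)
  have "D e = e" "R e = e" using e(1) by auto
  then have le: "(e, D t) \<in> le" using e(2) by (simp add: prod_iff)
  then have "s = restr e t"
    using prod_identity_left[OF t \<open>D e = e\<close>] e(2) by simp
  then show "(s, t) \<in> le" using restr_le[OF t \<open>D e = e\<close> le] by simp
next
  fix s t assume st: "(s, t) \<in> le"
  then have C: "s \<in> C" "t \<in> C" using le_closed by blast+
  then have "prod (D s) t = Some s"
    using prod_identity_left[of t "D s"] O2[OF st] restr_D[OF st] by simp
  with C show "(s, t) \<in> natural_order C prod D" by (auto simp: natural_order_def)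
qed

lemma restriction_product_left_cancellative:
  assumes "left_cancellative_category m"
  shows "left_cancellative_constellation prod R"
  unfolding left_cancellative_constellation_def
proof (intro allI impI, elim conjE)
  fix a b c u
  assume "prod a b = Some u" "prod a c = Some u"
  then have C: "a \<in> C" "b \<in> C" "c \<in> C" "(R a, D b) \<in> le" "(R a, D c) \<in> le"
    and "m a (restr (R a) b) = Some u" "m a (restr (R a) c) = Some u"
    by (auto simp: prod_iff)
  \<comment> \<open>Cancelling \<open>a\<close> in the category equates the restrictions, which are
    the products of \<open>R a\<close> with \<open>b\<close> and \<open>c\<close>.\<close>
  then have "restr (R a) b = restr (R a) c"
    using assms unfolding left_cancellative_category_def by blast
  then show "\<exists>v. prod (R a) b = Some v \<and> prod (R a) c = Some v"
    using C prod_identity_left by simp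
qed

end

theorem theorem5p7:
  fixes Q :: "'a set" and m :: "'a \<Rightarrow> 'a \<Rightarrow> 'a option" and DQ RQ :: "'a \<Rightarrow> 'a"
    and C :: "'b set" and c :: "'b \<Rightarrow> 'b \<Rightarrow> 'b option" and DC RC :: "'b \<Rightarrow> 'b" and le :: "'b rel"
  shows
    "(constellation_with_range Q m DQ RQ \<longrightarrow>
        ordered_category_with_restrictions Q (derived_comp m DQ RQ) DQ RQ (natural_order Q m DQ)
      \<and> (\<forall>s\<in>Q. \<forall>e\<in>DQ ` Q. (e, DQ s) \<in> natural_order Q m DQ \<longrightarrow>
           m e s = Some (restriction Q DQ (natural_order Q m DQ) e s))
      \<and> (left_cancellative_constellation m RQ \<longrightarrow>
           left_cancellative_category (derived_comp m DQ RQ)))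
   \<and> (ordered_category_with_restrictions C c DC RC le \<longrightarrow>
        constellation_with_range C (restriction_product C c DC RC le) DC RC
      \<and> natural_order C (restriction_product C c DC RC le) DC = le
      \<and> (left_cancellative_category c \<longrightarrow>
           left_cancellative_constellation (restriction_product C c DC RC le) RC))"
proof (intro conjI impI ballI)
  assume "constellation_with_range Q m DQ RQ"
  then interpret Q: constellation_with_range Q m DQ RQ .
  show "ordered_category_with_restrictions Q (derived_comp m DQ RQ) DQ RQ (natural_order Q m DQ)"
    by (rule Q.derived_ordered_category)
  show "m e s = Some (restriction Q DQ (natural_order Q m DQ) e s)"
    if "s \<in> Q" "e \<in> DQ ` Q" "(e, DQ s) \<in> natural_order Q m DQ" for s e
    using that by (rule Q.restriction_eq_mult)
  show "left_cancellative_category (derived_comp m DQ RQ)"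
    if "left_cancellative_constellation m RQ"
    using that by (rule Q.derived_left_cancellative)
next
  assume "ordered_category_with_restrictions C c DC RC le"
  then interpret C: ordered_category_with_restrictions C c DC RC le .
  show "constellation_with_range C (restriction_product C c DC RC le) DC RC"
    by (rule C.restriction_product_constellation_with_range)
  show "natural_order C (restriction_product C c DC RC le) DC = le"
    by (rule C.natural_order_restriction_product)
  show "left_cancellative_constellation (restriction_product C c DC RC le) RC"
    if "left_cancellative_category c"
    using that by (rule C.restriction_product_left_cancellative)
qed

end
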